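(* Let $B$ be an arbitrary semisimple finite-dimensional algebra over $\mathbb{C}$. Then $\mathcal{T}_{Lie}(B)=\mathcal{N}_{Lie}(B)$.
   Context: For a unital associative algebra $B$, $B^{op}$ denotes the opposite algebra (same linear space, product $a*b=ba$), and $B\otimes B^{op}$ is the algebraic tensor product algebra. $\mathcal{T}_{Lie}(B)$ is the subalgebra (not required to contain the unit) of $B\otimes B^{op}$ generated by all elements $a\otimes 1-1\otimes a$, $a\in B$. $\mathcal{N}_{Lie}(B)$ is the subalgebra of $B\otimes B^{op}$ consisting of all tensors $\sum_k a_k\otimes b_k$ (finite sums) such that $\sum_k a_kb_k=0$ and $\sum_k b_ka_k=0$, the products being taken in $B$. *)

theory Defs
  imports Complex_Main "HOL-Library.Poly_Mapping"
begin

section \<open>Unital associative complex algebras\<close>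

text \<open>The sorts \<open>ring\<close> and \<open>monoid_mult\<close> are used instead of \<open>ring_1\<close>, so that
  the zero algebra (\<open>0 = 1\<close>) is not excluded.\<close>

class complex_algebra = ring + monoid_mult +
  fixes scaleC :: "complex \<Rightarrow> 'a \<Rightarrow> 'a"  (infixr \<open>*\<^sub>C\<close> 75)
  assumes scaleC_add_right: "c *\<^sub>C (x + y) = c *\<^sub>C x + c *\<^sub>C y"
    and scaleC_add_left: "(c + d) *\<^sub>C x = c *\<^sub>C x + d *\<^sub>C x"
    and scaleC_scaleC: "c *\<^sub>C (d *\<^sub>C x) = (c * d) *\<^sub>C x"
    and scaleC_one: "1 *\<^sub>C x = x"
    and mult_scaleC_left: "(c *\<^sub>C x) * y = c *\<^sub>C (x * y)"
    and mult_scaleC_right: "x * (c *\<^sub>C y) = c *\<^sub>C (x * y)"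

global_interpretation complex_algebra: vector_space "scaleC :: complex \<Rightarrow> 'a::complex_algebra \<Rightarrow> 'a"
  by unfold_locales
    (simp_all add: scaleC_add_right scaleC_add_left scaleC_scaleC scaleC_one)

definition finite_dimensional :: "'a::complex_algebra itself \<Rightarrow> bool"
  where "finite_dimensional _ \<longleftrightarrow> (\<exists>S::'a set. finite S \<and> complex_algebra.span S = UNIV)"

text \<open>Subalgebras need not contain the unit.\<close>

definition subalgebra :: "'a::complex_algebra set \<Rightarrow> bool"
  where "subalgebra S \<longleftrightarrow> complex_algebra.subspace S \<and> (\<forall>x\<in>S. \<forall>y\<in>S. x * y \<in> S)"


section \<open>Semisimplicity\<close>

text \<open>Since the algebras are unital, left ideals are automatically linear subspaces:
  \<open>c *\<^sub>C x = (c *\<^sub>C 1) * x\<close>, and closed under negation.\<close>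

definition left_ideal :: "'a::complex_algebra set \<Rightarrow> bool"
  where "left_ideal I \<longleftrightarrow>
    0 \<in> I \<and> (\<forall>x\<in>I. \<forall>y\<in>I. x + y \<in> I) \<and> (\<forall>r. \<forall>x\<in>I. r * x \<in> I)"

definition maximal_left_ideal :: "'a::complex_algebra set \<Rightarrow> bool"
  where "maximal_left_ideal M \<longleftrightarrow>
    left_ideal M \<and> M \<noteq> UNIV \<and> (\<forall>I. left_ideal I \<and> M \<subseteq> I \<and> I \<noteq> UNIV \<longrightarrow> I = M)"

definition jacobson_radical :: "'a::complex_algebra set"
  where "jacobson_radical = \<Inter>{M. maximal_left_ideal M}"

definition semisimple :: "'a::complex_algebra itself \<Rightarrow> bool"
  where "semisimple _ \<longleftrightarrow> (jacobson_radical :: 'a set) = {0}"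


section \<open>The opposite algebra\<close>

datatype 'a opposite = Opp (unopp: 'a)

instantiation opposite :: (complex_algebra) complex_algebra
begin

definition "0 = Opp 0"
definition "1 = Opp 1"
definition "x + y = Opp (unopp x + unopp y)"
definition "- x = Opp (- unopp x)"
definition "x - y = Opp (unopp x - unopp y)"
definition "x * y = Opp (unopp y * unopp x)"
definition "c *\<^sub>C x = Opp (c *\<^sub>C unopp x)"

instance
  by standard
    (simp_all add: zero_opposite_def one_opposite_def plus_opposite_def uminus_opposite_def
      minus_opposite_def times_opposite_def scaleC_opposite_def algebra_simps
      scaleC_add_right scaleC_add_left scaleC_scaleC scaleC_one mult_scaleC_left mult_scaleC_right)

end


section \<open>The algebraic tensor product of two algebras\<close>

text \<open>\<open>A \<otimes> B\<close> is the free complex vector space on \<open>A \<times> B\<close> modulo the span of the bilinearity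
  relations. The multiplication that \<open>Poly_Mapping\<close> provides (convolution along
  addition of keys) plays no role here; \<open>formal_mult\<close> is the bilinear extension of
  \<open>(a, b) (a', b') = (a a', b b')\<close>.\<close>

type_synonym ('a, 'b) formal = "('a \<times> 'b) \<Rightarrow>\<^sub>0 complex"

definition formal_scale :: "complex \<Rightarrow> ('k \<Rightarrow>\<^sub>0 complex) \<Rightarrow> ('k \<Rightarrow>\<^sub>0 complex)"
  where "formal_scale c f = Poly_Mapping.map ((*) c) f"

abbreviation basis :: "'k \<Rightarrow> ('k \<Rightarrow>\<^sub>0 complex)"
  where "basis k \<equiv> Poly_Mapping.single k 1"

lemma lookup_formal_scale [simp]:
  "Poly_Mapping.lookup (formal_scale c f) k = c * Poly_Mapping.lookup f k"
  by (simp add: formal_scale_def Poly_Mapping.map.rep_eq when_def)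

global_interpretation formal: vector_space formal_scale
  by unfold_locales (auto intro!: poly_mapping_eqI simp: lookup_add algebra_simps)

definition tensor_relations :: "('a::complex_algebra, 'b::complex_algebra) formal set"
  where "tensor_relations =
      {basis (a + a', b) - basis (a, b) - basis (a', b) | a a' b. True}
    \<union> {basis (a, b + b') - basis (a, b) - basis (a, b') | a b b'. True}
    \<union> {basis (c *\<^sub>C a, b) - formal_scale c (basis (a, b)) | c a b. True}
    \<union> {basis (a, c *\<^sub>C b) - formal_scale c (basis (a, b)) | c a b. True}"

definition tensor_rel ::
  "('a::complex_algebra, 'b::complex_algebra) formal \<Rightarrow> ('a, 'b) formal \<Rightarrow> bool"
  where "tensor_rel f g \<longleftrightarrow> f - g \<in> formal.span tensor_relations"

definition formal_extend ::
  "('k \<Rightarrow> ('l \<Rightarrow>\<^sub>0 complex)) \<Rightarrow> ('k \<Rightarrow>\<^sub>0 complex) \<Rightarrow> ('l \<Rightarrow>\<^sub>0 complex)"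
  where "formal_extend h f =
    (\<Sum>k\<in>Poly_Mapping.keys f. formal_scale (Poly_Mapping.lookup f k) (h k))"

definition formal_mult ::
  "('a::complex_algebra, 'b::complex_algebra) formal \<Rightarrow> ('a, 'b) formal \<Rightarrow> ('a, 'b) formal"
  where "formal_mult f g =
    formal_extend (\<lambda>(a, b). formal_extend (\<lambda>(a', b'). basis (a * a', b * b')) g) f"

lemma formal_extend_superset:
  assumes "finite K" "Poly_Mapping.keys f \<subseteq> K"
  shows "formal_extend h f = (\<Sum>k\<in>K. formal_scale (Poly_Mapping.lookup f k) (h k))"
  unfolding formal_extend_def
  by (rule sum.mono_neutral_left) (use assms in \<open>auto simp: in_keys_iff\<close>)

lemma formal_extend_add: "formal_extend h (f + g) = formal_extend h f + formal_extend h g"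
proof -
  let ?K = "Poly_Mapping.keys f \<union> Poly_Mapping.keys g"
  have "Poly_Mapping.keys (f + g) \<subseteq> ?K"
    by (rule keys_add)
  then show ?thesis
    by (simp add: formal_extend_superset[of ?K] lookup_add formal.scale_left_distrib sum.distrib)
qed

lemma formal_extend_scale: "formal_extend h (formal_scale c f) = formal_scale c (formal_extend h f)"
proof -
  have "Poly_Mapping.keys (formal_scale c f) \<subseteq> Poly_Mapping.keys f"
    by (auto simp: in_keys_iff)
  then show ?thesis
    by (simp add: formal_extend_superset[of "Poly_Mapping.keys f"] formal.scale_sum_right)
qed

lemma formal_extend_basis [simp]: "formal_extend h (basis k) = h k"
  by (simp add: formal_extend_def)

lemma formal_extend_linear: "Vector_Spaces.linear formal_scale formal_scale (formal_extend h)"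
  by unfold_locales (simp_all add: formal_extend_add formal_extend_scale)

lemma formal_extend_fun_linear:
  assumes "\<And>k. Vector_Spaces.linear formal_scale formal_scale (\<lambda>g. h g k)"
  shows "Vector_Spaces.linear formal_scale formal_scale (\<lambda>g. formal_extend (h g) f)"
proof -
  interpret h: Vector_Spaces.linear formal_scale formal_scale "\<lambda>g. h g k" for k
    by (rule assms)
  show ?thesis
    by unfold_locales
      (simp_all add: formal_extend_def h.add h.scale formal.scale_right_distrib sum.distrib
        formal.scale_sum_right mult.commute)
qed

lemma formal_mult_linear_left:
  "Vector_Spaces.linear formal_scale formal_scale (\<lambda>f. formal_mult f g)"
  unfolding formal_mult_def by (rule formal_extend_linear)

lemma formal_mult_linear_right:
  "Vector_Spaces.linear formal_scale formal_scale (\<lambda>g. formal_mult f g)"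
  unfolding formal_mult_def
  by (rule formal_extend_fun_linear) (auto simp: case_prod_unfold intro: formal_extend_linear)

global_interpretation formal_mult_left:
  Vector_Spaces.linear formal_scale formal_scale "\<lambda>f. formal_mult f g" for g
  by (rule formal_mult_linear_left)

global_interpretation formal_mult_right:
  Vector_Spaces.linear formal_scale formal_scale "\<lambda>g. formal_mult f g" for f
  by (rule formal_mult_linear_right)

lemma formal_mult_basis [simp]:
  "formal_mult (basis (a, b)) (basis (a', b')) = basis (a * a', b * b')"
  by (simp add: formal_mult_def)

lemma formal_decompose:
  "f = (\<Sum>k\<in>Poly_Mapping.keys f. formal_scale (Poly_Mapping.lookup f k) (basis k))"
  by (rule poly_mapping_eqI)
    (auto simp: lookup_sum lookup_single when_def in_keys_iff if_distrib cong: if_cong)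

lemma formal_induct [case_names zero add scale basis]:
  assumes "P 0" "\<And>f g. P f \<Longrightarrow> P g \<Longrightarrow> P (f + g)"
    "\<And>c f. P f \<Longrightarrow> P (formal_scale c f)" "\<And>k. P (basis k)"
  shows "P f"
proof -
  have "P (\<Sum>k\<in>K. formal_scale (Poly_Mapping.lookup f k) (basis k))" if "finite K" for K
    using that by induction (auto intro: assms)
  then show ?thesis
    using formal_decompose[of f] by (metis finite_keys)
qed

lemma formal_mult_relations_left:
  assumes "r \<in> formal.span tensor_relations"
  shows "formal_mult r f \<in> formal.span tensor_relations"
  using assms
proof (induction r rule: formal.span_induct)
  case base
  show ?case
    by (auto simp: formal.subspace_def formal_mult_left.zero formal_mult_left.add
        formal_mult_left.scale formal.span_zero intro: formal.span_add formal.span_scale)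
next
  case (step r)
  show ?case
  proof (induction f rule: formal_induct)
    case (basis k)
    obtain x y where k: "k = (x, y)"
      by fastforce
    have "formal_mult r (basis k) \<in> tensor_relations"
      using step unfolding tensor_relations_def k
      by (auto simp: formal_mult_left.diff formal_mult_left.scale distrib_right mult_scaleC_left)
        metis+
    then show ?case
      by (rule formal.span_base)
  qed (auto simp: formal_mult_right.zero formal_mult_right.add formal_mult_right.scale
      formal.span_zero intro: formal.span_add formal.span_scale)
qed

lemma formal_mult_relations_right:
  assumes "r \<in> formal.span tensor_relations"
  shows "formal_mult f r \<in> formal.span tensor_relations"
  using assms
proof (induction r rule: formal.span_induct)
  case base
  show ?case
    by (auto simp: formal.subspace_def formal_mult_right.zero formal_mult_right.add
        formal_mult_right.scale formal.span_zero intro: formal.span_add formal.span_scale)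
next
  case (step r)
  show ?case
  proof (induction f rule: formal_induct)
    case (basis k)
    obtain x y where k: "k = (x, y)"
      by fastforce
    have "formal_mult (basis k) r \<in> tensor_relations"
      using step unfolding tensor_relations_def k
      by (auto simp: formal_mult_right.diff formal_mult_right.scale distrib_left mult_scaleC_right)
        metis+
    then show ?case
      by (rule formal.span_base)
  qed (auto simp: formal_mult_left.zero formal_mult_left.add formal_mult_left.scale
      formal.span_zero intro: formal.span_add formal.span_scale)
qed

lemma formal_mult_assoc: "formal_mult (formal_mult f g) h = formal_mult f (formal_mult g h)"
proof (induction f rule: formal_induct)
  case (basis k)
  show ?case
  proof (induction g rule: formal_induct)
    case (basis l)
    show ?case
    proof (induction h rule: formal_induct)
      case (basis m)
      show ?case
        by (cases k; cases l; cases m) (simp add: mult.assoc)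
    qed (simp_all add: formal_mult_right.zero formal_mult_right.add formal_mult_right.scale)
  qed (simp_all add: formal_mult_left.zero formal_mult_left.add formal_mult_left.scale
      formal_mult_right.zero formal_mult_right.add formal_mult_right.scale)
qed (simp_all add: formal_mult_left.zero formal_mult_left.add formal_mult_left.scale)

lemma formal_mult_one_left: "formal_mult (basis (1, 1)) f = f"
proof (induction f rule: formal_induct)
  case (basis k)
  show ?case by (cases k) simp
qed (simp_all add: formal_mult_right.zero formal_mult_right.add formal_mult_right.scale)

lemma formal_mult_one_right: "formal_mult f (basis (1, 1)) = f"
proof (induction f rule: formal_induct)
  case (basis k)
  show ?case by (cases k) simp
qed (simp_all add: formal_mult_left.zero formal_mult_left.add formal_mult_left.scale)

lemma tensor_rel_equivp: "equivp tensor_rel"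
proof (rule equivpI)
  show "reflp tensor_rel"
    by (simp add: reflp_def tensor_rel_def formal.span_zero)
  show "symp tensor_rel"
    unfolding symp_def tensor_rel_def by (metis formal.span_neg minus_diff_eq)
  show "transp tensor_rel"
    unfolding transp_def tensor_rel_def using formal.span_add by fastforce
qed

quotient_type (overloaded) ('a, 'b) tensor =
  "('a::complex_algebra, 'b::complex_algebra) formal" / tensor_rel
  by (rule tensor_rel_equivp)

instantiation tensor :: (complex_algebra, complex_algebra) complex_algebra
begin

lift_definition zero_tensor :: "('a, 'b) tensor" is 0 .

lift_definition one_tensor :: "('a, 'b) tensor" is "basis (1, 1)" .

lift_definition plus_tensor :: "('a, 'b) tensor \<Rightarrow> ('a, 'b) tensor \<Rightarrow> ('a, 'b) tensor" is "(+)"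
  unfolding tensor_rel_def by (simp add: add_diff_add formal.span_add)

lift_definition uminus_tensor :: "('a, 'b) tensor \<Rightarrow> ('a, 'b) tensor" is uminus
proof -
  fix f f' :: "('a, 'b) formal"
  assume "tensor_rel f f'"
  then show "tensor_rel (- f) (- f')"
    unfolding tensor_rel_def using formal.span_neg[of "f - f'"] by simp
qed

lift_definition minus_tensor :: "('a, 'b) tensor \<Rightarrow> ('a, 'b) tensor \<Rightarrow> ('a, 'b) tensor" is "(-)"
proof -
  fix f f' g g' :: "('a, 'b) formal"
  assume "tensor_rel f f'" "tensor_rel g g'"
  moreover have "(f - g) - (f' - g') = (f - f') - (g - g')"
    by simp
  ultimately show "tensor_rel (f - g) (f' - g')"
    unfolding tensor_rel_def by (simp only: formal.span_diff)
qed

lift_definition times_tensor :: "('a, 'b) tensor \<Rightarrow> ('a, 'b) tensor \<Rightarrow> ('a, 'b) tensor"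
  is formal_mult
proof -
  fix f f' g g' :: "('a, 'b) formal"
  assume "tensor_rel f f'" "tensor_rel g g'"
  moreover have "formal_mult f g - formal_mult f' g' =
      formal_mult (f - f') g + formal_mult f' (g - g')"
    by (simp add: formal_mult_left.diff formal_mult_right.diff)
  ultimately show "tensor_rel (formal_mult f g) (formal_mult f' g')"
    unfolding tensor_rel_def
    by (simp only: formal.span_add formal_mult_relations_left formal_mult_relations_right)
qed

lift_definition scaleC_tensor :: "complex \<Rightarrow> ('a, 'b) tensor \<Rightarrow> ('a, 'b) tensor"
  is formal_scale
  unfolding tensor_rel_def by (simp add: formal.span_scale flip: formal.scale_right_diff_distrib)

instance
proof
  fix x y z :: "('a, 'b) tensor" and c d :: complex
  have refl: "tensor_rel f f" for f :: "('a, 'b) formal"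
    by (simp add: tensor_rel_def formal.span_zero)
  show "x + y + z = x + (y + z)"
    by transfer (simp add: add.assoc refl)
  show "x + y = y + x"
    by transfer (simp add: add.commute refl)
  show "0 + x = x"
    by transfer (simp add: refl)
  show "- x + x = 0"
    by transfer (simp add: refl)
  show "x - y = x + - y"
    by transfer (simp add: refl)
  show "x * y * z = x * (y * z)"
    by transfer (simp add: formal_mult_assoc refl)
  show "1 * x = x"
    by transfer (simp add: formal_mult_one_left refl)
  show "x * 1 = x"
    by transfer (simp add: formal_mult_one_right refl)
  show "(x + y) * z = x * z + y * z"
    by transfer (simp add: formal_mult_left.add refl)
  show "x * (y + z) = x * y + x * z"
    by transfer (simp add: formal_mult_right.add refl)
  show "c *\<^sub>C (x + y) = c *\<^sub>C x + c *\<^sub>C y"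
    by transfer (simp add: formal.scale_right_distrib refl)
  show "(c + d) *\<^sub>C x = c *\<^sub>C x + d *\<^sub>C x"
    by transfer (simp add: formal.scale_left_distrib refl)
  show "c *\<^sub>C (d *\<^sub>C x) = (c * d) *\<^sub>C x"
    by transfer (simp add: refl)
  show "1 *\<^sub>C x = x"
    by transfer (simp add: refl)
  show "(c *\<^sub>C x) * y = c *\<^sub>C (x * y)"
    by transfer (simp add: formal_mult_left.scale refl)
  show "x * (c *\<^sub>C y) = c *\<^sub>C (x * y)"
    by transfer (simp add: formal_mult_right.scale refl)
qed

end

lift_definition tensor :: "'a::complex_algebra \<Rightarrow> 'b::complex_algebra \<Rightarrow> ('a, 'b) tensor"
  (infixr \<open>\<otimes>\<close> 72) is "\<lambda>a b. basis (a, b)" .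

lemma tensor_mult: "(a \<otimes> b) * (a' \<otimes> b') = (a * a') \<otimes> (b * b')"
  by transfer (simp add: tensor_rel_def formal.span_zero)

lemma one_tensor: "1 = 1 \<otimes> 1"
  by transfer (simp add: tensor_rel_def formal.span_zero)

lemma tensor_relationsI:
  "basis (a + a', b) - basis (a, b) - basis (a', b) \<in> tensor_relations"
  "basis (a, b + b') - basis (a, b) - basis (a, b') \<in> tensor_relations"
  "basis (c *\<^sub>C a, b) - formal_scale c (basis (a, b)) \<in> tensor_relations"
  "basis (a, c *\<^sub>C b) - formal_scale c (basis (a, b)) \<in> tensor_relations"
  unfolding tensor_relations_def by blast+

lemma tensor_add_left: "(a + a') \<otimes> b = a \<otimes> b + a' \<otimes> b"
  by transfer
    (metis tensor_rel_def diff_diff_eq formal.span_base tensor_relationsI(1))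

lemma tensor_add_right: "a \<otimes> (b + b') = a \<otimes> b + a \<otimes> b'"
  by transfer
    (metis tensor_rel_def diff_diff_eq formal.span_base tensor_relationsI(2))

lemma tensor_scaleC_left: "(c *\<^sub>C a) \<otimes> b = c *\<^sub>C (a \<otimes> b)"
  by transfer (metis tensor_rel_def formal.span_base tensor_relationsI(3))

lemma tensor_scaleC_right: "a \<otimes> (c *\<^sub>C b) = c *\<^sub>C (a \<otimes> b)"
  by transfer (metis tensor_rel_def formal.span_base tensor_relationsI(4))


section \<open>The algebras \<open>T_Lie\<close> and \<open>N_Lie\<close>\<close>

definition T_Lie :: "('a::complex_algebra, 'a opposite) tensor set"
  where "T_Lie = subalgebra hull {a \<otimes> 1 - 1 \<otimes> Opp a | a. True}"

text \<open>The products \<open>a k * b k\<close> and \<open>b k * a k\<close> below are taken in the algebra itself,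
  not in its opposite.\<close>

definition N_Lie :: "('a::complex_algebra, 'a opposite) tensor set"
  where "N_Lie = {\<Sum>k<n. a k \<otimes> Opp (b k) | (n::nat) a b.
    (\<Sum>k<n. a k * b k) = 0 \<and> (\<Sum>k<n. b k * a k) = 0}"

end

theory Submission
  imports Defs "HOL-Computational_Algebra.Fundamental_Theorem_Algebra"
begin

text \<open>
  Write \<open>ad a = a \<otimes> 1 - 1 \<otimes> a\<close>. In a semisimple algebra \<open>1\<close> is a sum of orthogonal
  idempotents \<open>p\<close> with one-dimensional corners \<open>p B p\<close>, and every \<open>p B q\<close> is at most
  one-dimensional. Polynomials in the \<open>ad p\<close> produce all \<open>p \<otimes> s\<close> with \<open>p \<noteq> s\<close>, and from these
  one gets \<open>D A D \<subseteq> T_Lie\<close>, where \<open>A\<close> is the enveloping algebra and \<open>D = \<Sum>\<^bsub>p \<noteq> s\<^esub> p \<otimes> s\<close>.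
  Since \<open>(1 - D) (ad a) (1 - D) = 0\<close>, each \<open>ad a\<close> lies in \<open>A D + D A\<close>, in such a way that
  \<open>(ad a) A (ad b) \<subseteq> T_Lie\<close>. An \<open>x\<close> in \<open>N_Lie\<close> belongs to the left ideal generated by the
  \<open>ad b\<close>, and a separability element \<open>u\<close> satisfies \<open>u x = 0\<close> with \<open>1 - u\<close> in the right ideal
  generated by the \<open>ad a\<close>; hence \<open>x = (1 - u) x\<close> is in \<open>T_Lie\<close>.
\<close>

section \<open>Semisimple algebras are semiprime\<close>

text \<open>If \<open>a\<close> lies outside a maximal left ideal \<open>M\<close>, then
  \<open>1 = r * a + m\<close> with \<open>m\<close> in \<open>M\<close>. Multiplying by
  \<open>a\<close> on the left kills \<open>a * r * a\<close> and leaves \<open>a = a * m\<close> in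
  \<open>M\<close>.\<close>

lemma semisimple_semiprime:
  fixes a :: "'b::complex_algebra"
  assumes ss: "semisimple TYPE('b)" and a: "\<And>x. a * x * a = 0"
  shows "a = 0"
proof -
  have "a \<in> M" if M: "maximal_left_ideal M" for M
  proof (rule ccontr)
    assume "a \<notin> M"
    let ?I = "{r * a + m | r m. m \<in> M}"
    have lM: "left_ideal M" and "M \<noteq> UNIV"
      and max: "\<And>I. left_ideal I \<Longrightarrow> M \<subseteq> I \<Longrightarrow> I \<noteq> UNIV \<Longrightarrow> I = M"
      using M unfolding maximal_left_ideal_def by auto
    have M0: "0 \<in> M" and Madd: "\<And>x y. x \<in> M \<Longrightarrow> y \<in> M \<Longrightarrow> x + y \<in> M"
      and Mmult: "\<And>r x. x \<in> M \<Longrightarrow> r * x \<in> M"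
      using lM unfolding left_ideal_def by auto
    have "left_ideal ?I"
      unfolding left_ideal_def
    proof (intro conjI ballI allI)
      have "0 = 0 * a + 0" by simp
      then show "0 \<in> ?I" using M0 by blast
    next
      fix x y assume "x \<in> ?I" "y \<in> ?I"
      then obtain r m r' m' where "x = r * a + m" "y = r' * a + m'" "m \<in> M" "m' \<in> M"
        by blast
      then have "x + y = (r + r') * a + (m + m')" "m + m' \<in> M"
        by (simp_all add: distrib_right Madd)
      then show "x + y \<in> ?I" by blast
    next
      fix s x assume "x \<in> ?I"
      then obtain r m where "x = r * a + m" "m \<in> M"
        by blast
      then have "s * x = (s * r) * a + s * m" "s * m \<in> M"
        by (simp_all add: distrib_left mult.assoc Mmult)
      then show "s * x \<in> ?I" by blast
    qed
    moreover have "M \<subseteq> ?I"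
    proof
      fix m assume "m \<in> M"
      moreover have "m = 0 * a + m" by simp
      ultimately show "m \<in> ?I" by blast
    qed
    moreover have "a \<in> ?I"
    proof -
      have "a = 1 * a + 0" by simp
      then show ?thesis using M0 by blast
    qed
    ultimately have "?I = UNIV"
      using max \<open>a \<notin> M\<close> by blast
    then obtain r m where rm: "1 = r * a + m" "m \<in> M"
      by blast
    have "a * 1 = a * r * a + a * m"
      by (subst rm(1)) (simp add: distrib_left mult.assoc)
    then have "a = a * m"
      using a by simp
    then show False
      using \<open>a \<notin> M\<close> Mmult[OF rm(2)] by metis
  qed
  then have "a \<in> jacobson_radical"
    unfolding jacobson_radical_def by auto
  then show ?thesis
    using ss unfolding semisimple_def by auto
qed


section \<open>Decomposition of the unit into minimal idempotents\<close>

text \<open>Primitivity is encoded as a one-dimensional corner, its equivalent over the complex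
  numbers in a finite-dimensional semisimple algebra; this scalar form feeds the computations
  directly.\<close>

definition minimal_idempotent :: "'a::complex_algebra \<Rightarrow> bool"
  where "minimal_idempotent p \<longleftrightarrow> p \<noteq> 0 \<and> p * p = p \<and> (\<forall>x. \<exists>c. p * x * p = c *\<^sub>C p)"

section \<open>Polynomials in one element and eigenvectors\<close>

text \<open>\<open>orbit_poly a t p = a * p(t)\<close>.\<close>

definition orbit_poly :: "'a::complex_algebra \<Rightarrow> 'a \<Rightarrow> complex poly \<Rightarrow> 'a"
  where "orbit_poly a t p = fold_coeffs (\<lambda>c y. c *\<^sub>C a + y * t) p 0"

lemma orbit_poly_0 [simp]: "orbit_poly a t 0 = 0"
  by (simp add: orbit_poly_def)

lemma orbit_poly_pCons [simp]: "orbit_poly a t (pCons c p) = c *\<^sub>C a + orbit_poly a t p * t"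
  by (cases "c = 0 \<and> p = 0") (auto simp: orbit_poly_def fold_coeffs_pCons_eq)

lemma orbit_poly_add: "orbit_poly a t (p + q) = orbit_poly a t p + orbit_poly a t q"
  by (induction p q rule: poly_induct2)
    (simp_all add: complex_algebra.scale_left_distrib distrib_right)

lemma orbit_poly_smult: "orbit_poly a t (smult c p) = c *\<^sub>C orbit_poly a t p"
  by (induction p)
    (simp_all add: complex_algebra.scale_right_distrib mult_scaleC_left)

lemma orbit_poly_in_left_ideal:
  assumes "t = s * a"
  shows "\<exists>z. orbit_poly a t p = z * a"
proof (induction p)
  case 0
  show ?case by (auto intro: exI[of _ 0])
next
  case (pCons c p)
  then obtain z where "orbit_poly a t p = z * a" by blast
  then have "orbit_poly a t (pCons c p) = (c *\<^sub>C 1 + z * a * s) * a"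
    by (simp add: assms distrib_right mult.assoc mult_scaleC_left)
  then show ?case by blast
qed

text \<open>In finite dimension the vectors \<open>a * t^i\<close> cannot all be independent, so
  some \<open>a * t^n\<close> is a combination of earlier ones.\<close>

lemma orbit_poly_annihilator:
  fixes a t :: "'a::complex_algebra"
  assumes S: "finite (S::'a set)" "complex_algebra.span S = UNIV"
  shows "\<exists>p. p \<noteq> 0 \<and> orbit_poly a t p = 0"
proof -
  define e where "e = (\<lambda>i. orbit_poly a t (monom 1 i))"
  have "\<exists>n. e n \<in> complex_algebra.span (e ` {..<n})"
  proof (rule ccontr)
    assume "\<nexists>n. e n \<in> complex_algebra.span (e ` {..<n})"
    then have *: "e n \<notin> complex_algebra.span (e ` {..<n})" for n
      by metis
    have "complex_algebra.independent (e ` {..<n}) \<and> card (e ` {..<n}) = n" for n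
    proof (induction n)
      case 0
      show ?case by (simp add: complex_algebra.independent_empty)
    next
      case (Suc n)
      have "e n \<notin> complex_algebra.span (e ` {..<n})"
        by (rule *)
      moreover have "e n \<notin> e ` {..<n}"
        using * complex_algebra.span_base by metis
      ultimately show ?case
        using Suc unfolding lessThan_Suc image_insert
        by (simp only: complex_algebra.independent_insert card_insert_disjoint finite_imageI
            finite_lessThan if_False simp_thms)
    qed
    from this[of "Suc (card S)"] show False
      using complex_algebra.independent_span_bound[OF S(1), of "e ` {..<Suc (card S)}"] S(2)
      by simp
  qed
  then obtain n where n: "e n \<in> complex_algebra.span (e ` {..<n})" by metis
  let ?V = "{orbit_poly a t p | p. \<forall>i\<ge>n. coeff p i = 0}"
  have "complex_algebra.subspace ?V"
    unfolding complex_algebra.subspace_def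
  proof (intro conjI ballI allI)
    show "0 \<in> ?V" by (auto intro!: exI[of _ 0])
  next
    fix x y assume "x \<in> ?V" "y \<in> ?V"
    then obtain p q where "x = orbit_poly a t p" "y = orbit_poly a t q"
      "\<forall>i\<ge>n. coeff p i = 0" "\<forall>i\<ge>n. coeff q i = 0" by blast
    then show "x + y \<in> ?V" by (auto intro!: exI[of _ "p + q"] simp: orbit_poly_add)
  next
    fix c x assume "x \<in> ?V"
    then obtain p where "x = orbit_poly a t p" "\<forall>i\<ge>n. coeff p i = 0" by blast
    then show "c *\<^sub>C x \<in> ?V" by (auto intro!: exI[of _ "smult c p"] simp: orbit_poly_smult)
  qed
  moreover have "e ` {..<n} \<subseteq> ?V"
    by (auto simp: e_def intro!: exI[of _ "monom 1 _"])
  ultimately have "e n \<in> ?V"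
    using n complex_algebra.span_minimal by blast
  then obtain p where p: "e n = orbit_poly a t p" "\<forall>i\<ge>n. coeff p i = 0" by blast
  \<comment> \<open>The coefficients of \<open>p\<close> vanish from \<open>n\<close> on, so this
    polynomial is monic and hence nonzero.\<close>
  let ?q = "monom 1 n + smult (-1) p"
  have "coeff ?q n = 1" using p(2) by simp
  then have "?q \<noteq> 0" by (metis coeff_0 zero_neq_one)
  moreover have "orbit_poly a t ?q = 0"
    by (simp only: orbit_poly_add orbit_poly_smult p(1)[symmetric] e_def) simp
  ultimately show ?thesis by blast
qed

text \<open>Split a root off an annihilating polynomial of least degree,
  \<open>p = (X - c) q\<close>. Minimality keeps \<open>a * q(t)\<close> nonzero, while
  \<open>a * q(t) * (t - c) = 0\<close>.\<close>

lemma orbit_poly_eigenvector: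
  fixes a t :: "'a::complex_algebra"
  assumes S: "finite (S::'a set)" "complex_algebra.span S = UNIV" and "a \<noteq> 0"
  shows "\<exists>q c. orbit_poly a t q \<noteq> 0 \<and> orbit_poly a t q * t = c *\<^sub>C orbit_poly a t q"
proof -
  obtain p where p: "p \<noteq> 0 \<and> orbit_poly a t p = 0"
    and min: "\<And>q. q \<noteq> 0 \<and> orbit_poly a t q = 0 \<Longrightarrow> degree p \<le> degree q"
    using ex_has_least_nat[where m = degree and P = "\<lambda>p. p \<noteq> 0 \<and> orbit_poly a t p = 0"]
      orbit_poly_annihilator[OF S] by blast
  have "degree p \<noteq> 0"
  proof
    assume "degree p = 0"
    then obtain c where "p = [:c:]" by (metis degree_eq_zeroE)
    then show False using p \<open>a \<noteq> 0\<close> by simp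
  qed
  then obtain c where "poly p c = 0"
    using fundamental_theorem_of_algebra by (metis constant_degree)
  then obtain q where q: "p = [:- c, 1:] * q"
    using poly_eq_0_iff_dvd by (metis dvdE)
  then have "q \<noteq> 0" using p by auto
  then have "degree q < degree p" by (simp add: q degree_mult_eq del: mult_pCons_left)
  then have "orbit_poly a t q \<noteq> 0" using min[of q] \<open>q \<noteq> 0\<close> by linarith
  moreover have "p = pCons 0 q + smult (- c) q" by (simp add: q)
  then have "orbit_poly a t q * t = c *\<^sub>C orbit_poly a t q"
    using p orbit_poly_add[of a t "pCons 0 q" "smult (- c) q"] orbit_poly_smult[of a t "- c" q]
    by simp
  ultimately show ?thesis by blast
qed

text \<open>Among the nonzero \<open>a\<close> with \<open>a * f = a\<close>, take one whose left
  ideal has least dimension; any nonzero \<open>z * a\<close> then generates that whole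
  ideal.\<close>

lemma minimal_left_ideal_generator:
  fixes f :: "'a::complex_algebra"
  assumes S: "finite (S::'a set)" "complex_algebra.span S = UNIV"
    and f: "f * f = f" "f \<noteq> 0"
  obtains a where "a \<noteq> 0" "a * f = a" "\<And>z. z * a \<noteq> 0 \<Longrightarrow> \<exists>d. a = d * (z * a)"
proof -
  obtain B where B: "complex_algebra.independent (B::'a set)" "complex_algebra.span B = UNIV"
    using complex_algebra.basis_exists[of UNIV] by (metis top.extremum_uniqueI)
  then have "finite B"
    using complex_algebra.independent_span_bound[OF S(1), of B] S(2) by simp
  then interpret fd: finite_dimensional_vector_space "scaleC :: complex \<Rightarrow> 'a \<Rightarrow> 'a" B
    using B by unfold_locales auto
  let ?L = "\<lambda>a. range (\<lambda>z. z * a)"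
  have sub: "complex_algebra.subspace (?L a)" for a :: 'a
    unfolding complex_algebra.subspace_def
  proof (intro conjI ballI allI)
    show "0 \<in> ?L a" by (auto intro: image_eqI[of _ _ 0])
  next
    fix x y assume "x \<in> ?L a" "y \<in> ?L a"
    then show "x + y \<in> ?L a" by (auto simp: distrib_right[symmetric])
  next
    fix c x assume "x \<in> ?L a"
    then show "c *\<^sub>C x \<in> ?L a" by (auto simp: mult_scaleC_left[symmetric])
  qed
  obtain a where a: "a \<noteq> 0 \<and> a * f = a"
    and min: "\<And>b. b \<noteq> 0 \<and> b * f = b \<Longrightarrow> complex_algebra.dim (?L a) \<le> complex_algebra.dim (?L b)"
    using ex_has_least_nat[where m = "\<lambda>a. complex_algebra.dim (?L a)"
        and P = "\<lambda>a. a \<noteq> 0 \<and> a * f = a" and k = f] f by blast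
  show thesis
  proof
    show "a \<noteq> 0" "a * f = a" using a by auto
    fix z assume z: "z * a \<noteq> 0"
    have "?L (z * a) \<subseteq> ?L a" by (auto simp: mult.assoc[symmetric])
    moreover have "complex_algebra.dim (?L a) \<le> complex_algebra.dim (?L (z * a))"
      using min[of "z * a"] z a by (simp add: mult.assoc)
    ultimately have "?L (z * a) = ?L a"
      using fd.subspace_dim_equal[OF sub sub] by blast
    moreover have "a \<in> ?L a" by (auto intro: image_eqI[of _ _ 1])
    ultimately show "\<exists>d. a = d * (z * a)" by auto
  qed
qed

text \<open>Schur's lemma: right multiplication by \<open>x * a\<close> on the minimal left ideal
  generated by \<open>a\<close> has an eigenvector, which generates the ideal, so the map is a
  scalar. Semiprimeness makes one such scalar nonzero, and normalising yields the
  idempotent.\<close>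

lemma minimal_idempotent_in_corner:
  fixes f :: "'a::complex_algebra"
  assumes S: "finite (S::'a set)" "complex_algebra.span S = UNIV"
    and semiprime: "\<And>a::'a. (\<And>x. a * x * a = 0) \<Longrightarrow> a = 0"
    and f: "f * f = f" "f \<noteq> 0"
  obtains h where "minimal_idempotent h" "f * h = h" "h * f = h"
proof -
  obtain a where a: "a \<noteq> 0" "a * f = a" and min: "\<And>z. z * a \<noteq> 0 \<Longrightarrow> \<exists>d. a = d * (z * a)"
    using minimal_left_ideal_generator[OF S f] by blast
  have scalar: "\<exists>c. a * (x * a) = c *\<^sub>C a" for x
  proof -
    obtain q c where q: "orbit_poly a (x * a) q \<noteq> 0"
      "orbit_poly a (x * a) q * (x * a) = c *\<^sub>C orbit_poly a (x * a) q"
      using orbit_poly_eigenvector[OF S a(1)] by blast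
    obtain z where z: "orbit_poly a (x * a) q = z * a"
      using orbit_poly_in_left_ideal by blast
    obtain d where d: "a = d * (z * a)" using min q(1) z by metis
    have "a * (x * a) = d * (z * a * (x * a))"
      by (subst d) (simp add: mult.assoc)
    also have "\<dots> = c *\<^sub>C a"
      using q(2) z d by (simp add: mult_scaleC_right)
    finally show ?thesis by blast
  qed
  obtain x where x: "a * x * a \<noteq> 0" using semiprime a(1) by blast
  \<comment> \<open>The factor \<open>f\<close> places \<open>t\<close> in the corner of
    \<open>f\<close> without affecting \<open>a * t\<close>, since \<open>a * f = a\<close>.\<close>
  define t where "t = f * x * a"
  obtain c where c: "a * t = c *\<^sub>C a"
    using scalar[of "f * x"] unfolding t_def by blast
  have "a * t = a * x * a" by (simp add: t_def a(2) mult.assoc[symmetric])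
  with x c have "c \<noteq> 0" by auto
  have tt: "t * t = c *\<^sub>C t"
  proof -
    have "t * t = f * x * (a * t)" by (simp add: t_def mult.assoc)
    also have "\<dots> = c *\<^sub>C (f * x * a)" by (simp only: c mult_scaleC_right)
    finally show ?thesis by (simp only: t_def)
  qed
  have "t \<noteq> 0" using c \<open>c \<noteq> 0\<close> a(1) by auto
  have ft: "f * t = t" "t * f = t"
    by (simp add: t_def mult.assoc[symmetric] f) (simp add: t_def mult.assoc a)
  have st: "\<exists>d. t * y * t = d *\<^sub>C t" for y
  proof -
    obtain d where "a * (y * f * x * a) = d *\<^sub>C a" using scalar[of "y * f * x"] by blast
    then have "t * y * t = d *\<^sub>C t"
      by (simp add: t_def mult.assoc mult_scaleC_right)
    then show ?thesis by blast
  qed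
  show thesis
  proof
    let ?h = "inverse c *\<^sub>C t"
    show "f * ?h = ?h" "?h * f = ?h"
      by (simp_all add: mult_scaleC_right mult_scaleC_left ft)
    have "\<exists>d. ?h * y * ?h = d *\<^sub>C ?h" for y
    proof -
      obtain d where "t * y * t = d *\<^sub>C t" using st by blast
      then have "?h * y * ?h = (inverse c * d) *\<^sub>C ?h"
        by (simp add: mult_scaleC_right mult_scaleC_left)
      then show ?thesis by blast
    qed
    moreover have "?h * ?h = ?h"
      using \<open>c \<noteq> 0\<close> by (simp add: mult_scaleC_right mult_scaleC_left tt)
    ultimately show "minimal_idempotent ?h"
      using \<open>c \<noteq> 0\<close> \<open>t \<noteq> 0\<close> by (simp add: minimal_idempotent_def)
  qed
qed

section \<open>Orthogonal families of minimal idempotents\<close>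

definition orthogonal_minimal_idempotents :: "'a::complex_algebra set \<Rightarrow> bool"
  where "orthogonal_minimal_idempotents P \<longleftrightarrow>
    finite P \<and> (\<forall>p\<in>P. minimal_idempotent p) \<and> (\<forall>p\<in>P. \<forall>q\<in>P. p \<noteq> q \<longrightarrow> p * q = 0)"

lemma
  assumes P: "orthogonal_minimal_idempotents P" and q: "q \<in> P"
  shows orthogonal_sum_mult_left: "q * (\<Sum>p\<in>P. c p *\<^sub>C p) = c q *\<^sub>C q"
    and orthogonal_sum_mult_right: "(\<Sum>p\<in>P. c p *\<^sub>C p) * q = c q *\<^sub>C q"
proof -
  have fin: "finite P" and id: "q * q = q"
    and orth: "\<And>p. p \<in> P \<Longrightarrow> p \<noteq> q \<Longrightarrow> q * p = 0" "\<And>p. p \<in> P \<Longrightarrow> p \<noteq> q \<Longrightarrow> p * q = 0"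
    using P q unfolding orthogonal_minimal_idempotents_def minimal_idempotent_def by auto
  have "q * (\<Sum>p\<in>P. c p *\<^sub>C p) = (\<Sum>p\<in>P. if p = q then c q *\<^sub>C q else 0)"
    unfolding sum_distrib_left
    by (rule sum.cong) (auto simp: mult_scaleC_right orth id)
  then show "q * (\<Sum>p\<in>P. c p *\<^sub>C p) = c q *\<^sub>C q"
    using fin q by simp
  have "(\<Sum>p\<in>P. c p *\<^sub>C p) * q = (\<Sum>p\<in>P. if p = q then c q *\<^sub>C q else 0)"
    unfolding sum_distrib_right
    by (rule sum.cong) (auto simp: mult_scaleC_left orth id)
  then show "(\<Sum>p\<in>P. c p *\<^sub>C p) * q = c q *\<^sub>C q"
    using fin q by simp
qed

text \<open>Multiplying a relation by \<open>q\<close> isolates its coefficient. Independence bounds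
  the size of such families.\<close>

lemma orthogonal_minimal_idempotents_independent:
  assumes P: "orthogonal_minimal_idempotents P"
  shows "complex_algebra.independent P"
proof -
  have fin: "finite P" and nz: "\<And>p. p \<in> P \<Longrightarrow> p \<noteq> 0"
    using P unfolding orthogonal_minimal_idempotents_def minimal_idempotent_def by auto
  have "c q = 0" if "(\<Sum>p\<in>P. c p *\<^sub>C p) = 0" "q \<in> P" for c q
    using orthogonal_sum_mult_left[OF P that(2), of c] that nz by simp
  then show ?thesis
    using fin complex_algebra.dependent_finite by blast
qed

text \<open>A family of greatest size must sum to \<open>1\<close>: otherwise
  \<open>1 - \<Sum>P\<close> is a nonzero idempotent orthogonal to \<open>P\<close>, and a minimal
  idempotent in its corner enlarges the family.\<close>

lemma minimal_idempotent_decomposition: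
  assumes fd: "finite_dimensional TYPE('a::complex_algebra)"
    and semiprime: "\<And>a::'a::complex_algebra. (\<And>x. a * x * a = 0) \<Longrightarrow> a = 0"
  obtains P :: "'a::complex_algebra set" where "orthogonal_minimal_idempotents P" "\<Sum>P = 1"
proof -
  obtain S :: "'a set" where S: "finite S" "complex_algebra.span S = UNIV"
    using fd unfolding finite_dimensional_def by auto
  have bound: "card P \<le> card S" if "orthogonal_minimal_idempotents P" for P :: "'a set"
    using complex_algebra.independent_span_bound[OF S(1)
        orthogonal_minimal_idempotents_independent[OF that]] S(2) by simp
  have "orthogonal_minimal_idempotents {}"
    by (simp add: orthogonal_minimal_idempotents_def)
  then obtain P :: "'a set" where P: "orthogonal_minimal_idempotents P"
    and max: "\<And>Q::'a set. orthogonal_minimal_idempotents Q \<Longrightarrow> card Q \<le> card P"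
    using ex_has_greatest_nat[of orthogonal_minimal_idempotents "{}" card "Suc (card S)"] bound
    by (metis le_imp_less_Suc)
  let ?f = "1 - \<Sum>P"
  have fin: "finite P" and nz: "\<And>p. p \<in> P \<Longrightarrow> p \<noteq> 0"
    using P unfolding orthogonal_minimal_idempotents_def minimal_idempotent_def by auto
  have fp: "q * ?f = 0" "?f * q = 0" if "q \<in> P" for q
    using orthogonal_sum_mult_left[OF P that, of "\<lambda>_. 1"]
      orthogonal_sum_mult_right[OF P that, of "\<lambda>_. 1"]
    by (simp_all add: right_diff_distrib left_diff_distrib)
  then have "\<Sum>P * ?f = 0"
    by (simp only: sum_distrib_right) simp
  then have ff: "?f * ?f = ?f"
    by (simp only: left_diff_distrib[of 1]) simp
  have "?f = 0"
  proof (rule ccontr)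
    assume "?f \<noteq> 0"
    then obtain h where h: "minimal_idempotent h" "?f * h = h" "h * ?f = h"
      using minimal_idempotent_in_corner[OF S semiprime ff] by blast
    have ph: "q * h = 0" "h * q = 0" if "q \<in> P" for q
    proof -
      have "q * (?f * h) = 0" "(h * ?f) * q = 0"
        using fp[OF that] by (simp only: mult.assoc[symmetric] mult_zero_left,
            simp only: mult.assoc mult_zero_right)
      then show "q * h = 0" "h * q = 0" using h by simp_all
    qed
    have "h \<notin> P"
      using ph(1)[of h] h(1) by (auto simp: minimal_idempotent_def)
    moreover have "orthogonal_minimal_idempotents (insert h P)"
      using P h(1) ph unfolding orthogonal_minimal_idempotents_def by auto
    then have "card (insert h P) \<le> card P" by (rule max)
    ultimately show False using fin by simp
  qed
  then show thesis using that[OF P] by simp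
qed


section \<open>The enveloping algebra\<close>

abbreviation env_tensor :: "'a::complex_algebra \<Rightarrow> 'a \<Rightarrow> ('a, 'a opposite) tensor" (infix \<open>\<odot>\<close> 72)
  where "a \<odot> b \<equiv> a \<otimes> Opp b"

lemma Opp_arith:
  "Opp a + Opp b = Opp (a + b)" "Opp a * Opp b = Opp (b * a)"
  "c *\<^sub>C Opp a = Opp (c *\<^sub>C a)" "0 = Opp 0" "1 = Opp 1"
  by (simp_all add: plus_opposite_def times_opposite_def scaleC_opposite_def zero_opposite_def
      one_opposite_def)

lemma env_tensor_mult: "(a \<odot> b) * (c \<odot> d) = (a * c) \<odot> (d * b)"
  by (simp add: tensor_mult Opp_arith)

lemma env_tensor_one: "1 = 1 \<odot> 1"
  by (simp add: one_tensor Opp_arith)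

lemma env_tensor_add_left: "(a + a') \<odot> b = a \<odot> b + a' \<odot> b"
  by (rule tensor_add_left)

lemma env_tensor_add_right: "a \<odot> (b + b') = a \<odot> b + a \<odot> b'"
  by (simp add: tensor_add_right flip: Opp_arith)

lemma env_tensor_scaleC_left: "(c *\<^sub>C a) \<odot> b = c *\<^sub>C (a \<odot> b)"
  by (rule tensor_scaleC_left)

lemma env_tensor_scaleC_right: "a \<odot> (c *\<^sub>C b) = c *\<^sub>C (a \<odot> b)"
  by (simp add: tensor_scaleC_right flip: Opp_arith)

lemma env_tensor_uminus_left: "(- a) \<odot> b = - (a \<odot> b)"
  using env_tensor_scaleC_left[of "- 1" a b] by simp

lemma env_tensor_zero [simp]: "0 \<odot> b = 0" "a \<odot> 0 = 0"
  using env_tensor_add_left[of 0 0 b] env_tensor_add_right[of a 0 0] by simp_all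

lemma env_tensor_sum_left: "(\<Sum>k\<in>K. f k) \<odot> b = (\<Sum>k\<in>K. f k \<odot> b)"
  by (induction K rule: infinite_finite_induct) (simp_all add: env_tensor_add_left)

lemma env_tensor_sum_right: "a \<odot> (\<Sum>k\<in>K. f k) = (\<Sum>k\<in>K. a \<odot> f k)"
  by (induction K rule: infinite_finite_induct) (simp_all add: env_tensor_add_right)

lemma env_tensor_induct [case_names add tensor]:
  fixes x :: "('a::complex_algebra, 'a opposite) tensor"
  assumes add: "\<And>x y. P x \<Longrightarrow> P y \<Longrightarrow> P (x + y)" and tensor: "\<And>a b. P (a \<odot> b)"
  shows "P x"
proof -
  \<comment> \<open>Carrying every scalar \<open>c\<close> along lets the scaling case compose
    scalars and the basis case absorb them into the left factor.\<close>
  have "\<forall>c. P (c *\<^sub>C abs_tensor f)" for f :: "('a, 'a opposite) formal"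
  proof (induction f rule: formal_induct)
    case zero
    have "P 0" using tensor[of 0 0] by simp
    moreover have "abs_tensor 0 = (0 :: ('a, 'a opposite) tensor)"
      by (simp add: zero_tensor_def)
    ultimately show ?case by simp
  next
    case (add f g)
    then show ?case
      by (simp add: assms(1) scaleC_add_right flip: plus_tensor.abs_eq)
  next
    case (scale c f)
    then show ?case by (simp add: scaleC_scaleC flip: scaleC_tensor.abs_eq)
  next
    case (basis k)
    obtain a b where "k = (a, Opp b)" by (metis opposite.exhaust surj_pair)
    then have "abs_tensor (Poly_Mapping.single k 1) = a \<odot> b"
      by (simp add: tensor.abs_eq)
    then show ?case by (simp add: tensor flip: env_tensor_scaleC_left)
  qed
  then have "P (1 *\<^sub>C abs_tensor (rep_tensor x))" by blast
  then show ?thesis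
    using Quotient3_abs_rep[OF Quotient3_tensor, of x] by (simp add: scaleC_one)
qed

definition ad_tensor :: "'a::complex_algebra \<Rightarrow> ('a, 'a opposite) tensor"
  where "ad_tensor a = a \<odot> 1 - 1 \<odot> a"

lemma T_Lie_ad: "ad_tensor a \<in> T_Lie"
  unfolding T_Lie_def ad_tensor_def
  by (rule hull_inc) (auto simp: Opp_arith)

lemma subalgebra_T_Lie: "subalgebra T_Lie"
  unfolding T_Lie_def
proof (rule hull_in)
  fix \<S> :: "('a, 'a opposite) tensor set set"
  assume "Ball \<S> subalgebra"
  then show "subalgebra (\<Inter>\<S>)"
    unfolding subalgebra_def complex_algebra.subspace_def by simp
qed

lemma
  shows T_Lie_mult: "x \<in> T_Lie \<Longrightarrow> y \<in> T_Lie \<Longrightarrow> x * y \<in> T_Lie"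
    and T_Lie_add: "x \<in> T_Lie \<Longrightarrow> y \<in> T_Lie \<Longrightarrow> x + y \<in> T_Lie"
    and T_Lie_scaleC: "x \<in> T_Lie \<Longrightarrow> c *\<^sub>C x \<in> T_Lie"
    and T_Lie_uminus: "x \<in> T_Lie \<Longrightarrow> - x \<in> T_Lie"
    and T_Lie_zero: "0 \<in> T_Lie"
    and T_Lie_sum: "(\<And>k. k \<in> K \<Longrightarrow> f k \<in> T_Lie) \<Longrightarrow> sum f K \<in> T_Lie"
  using subalgebra_T_Lie unfolding subalgebra_def
  by (auto intro: complex_algebra.subspace_add complex_algebra.subspace_scale
      complex_algebra.subspace_neg complex_algebra.subspace_0 complex_algebra.subspace_sum)


section \<open>\<open>T_Lie\<close> is contained in \<open>N_Lie\<close>\<close>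

text \<open>Passes from initial segments of the naturals to arbitrary finite index sets, so that
  disjoint unions and products can index the sums below.\<close>

lemma N_LieI:
  assumes "finite K" "(\<Sum>k\<in>K. a k * b k) = 0" "(\<Sum>k\<in>K. b k * a k) = 0"
  shows "(\<Sum>k\<in>K. a k \<odot> b k) \<in> N_Lie"
proof -
  obtain h where h: "bij_betw h {..<card K} K"
    using ex_bij_betw_nat_finite[OF assms(1)] by (auto simp: atLeast0LessThan)
  have "(\<Sum>k\<in>K. a k \<odot> b k) = (\<Sum>i<card K. a (h i) \<odot> b (h i))"
    by (simp add: sum.reindex_bij_betw[OF h, of "\<lambda>k. a k \<odot> b k"])
  moreover have "(\<Sum>i<card K. a (h i) * b (h i)) = 0" "(\<Sum>i<card K. b (h i) * a (h i)) = 0"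
    using assms by (simp_all add: sum.reindex_bij_betw[OF h, of "\<lambda>k. a k * b k"]
        sum.reindex_bij_betw[OF h, of "\<lambda>k. b k * a k"])
  ultimately show ?thesis
    unfolding N_Lie_def
    by (intro CollectI exI[of _ "card K"] exI[of _ "\<lambda>i. a (h i)"] exI[of _ "\<lambda>i. b (h i)"] conjI)
qed

lemma N_LieE:
  assumes "x \<in> N_Lie"
  obtains n :: nat and a b where "x = (\<Sum>k<n. a k \<odot> b k)"
    "(\<Sum>k<n. a k * b k) = 0" "(\<Sum>k<n. b k * a k) = 0"
  using assms unfolding N_Lie_def by blast

lemma subalgebra_N_Lie: "subalgebra N_Lie"
  unfolding subalgebra_def complex_algebra.subspace_def
proof (intro conjI ballI allI)
  show "0 \<in> N_Lie" using N_LieI[of "{}"] by simp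
next
  fix x y :: "('a, 'a opposite) tensor"
  assume x: "x \<in> N_Lie" and y: "y \<in> N_Lie"
  obtain n :: nat and a b where x: "x = (\<Sum>k<n. a k \<odot> b k)"
    "(\<Sum>k<n. a k * b k) = 0" "(\<Sum>k<n. b k * a k) = 0" using x by (blast elim: N_LieE)
  obtain m :: nat and c d where y: "y = (\<Sum>k<m. c k \<odot> d k)"
    "(\<Sum>k<m. c k * d k) = 0" "(\<Sum>k<m. d k * c k) = 0" using y by (blast elim: N_LieE)
  show "x + y \<in> N_Lie"
    using N_LieI[of "{..<n::nat} <+> {..<m::nat}" "case_sum a c" "case_sum b d"] x y
    by (simp add: sum.Plus)
  \<comment> \<open>In one order of multiplication the vanishing sum of \<open>y\<close> is nested
    between the factors of \<open>x\<close>; in the other, that of \<open>x\<close> between the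
    factors of \<open>y\<close>.\<close>
  have "(\<Sum>k\<in>{..<n} \<times> {..<m}. (a (fst k) * c (snd k)) * (d (snd k) * b (fst k)))
      = (\<Sum>i<n. a i * (\<Sum>j<m. c j * d j) * b i)"
    by (simp add: sum_distrib_left sum_distrib_right mult.assoc sum.cartesian_product'
        case_prod_unfold)
  moreover have "(\<Sum>k\<in>{..<n} \<times> {..<m}. (d (snd k) * b (fst k)) * (a (fst k) * c (snd k)))
      = (\<Sum>j<m. d j * (\<Sum>i<n. b i * a i) * c j)"
  proof -
    have "(\<Sum>k\<in>{..<n} \<times> {..<m}. (d (snd k) * b (fst k)) * (a (fst k) * c (snd k)))
        = (\<Sum>i<n. \<Sum>j<m. d j * (b i * (a i * c j)))"
      by (simp add: sum.cartesian_product case_prod_unfold mult.assoc)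
    also have "\<dots> = (\<Sum>j<m. \<Sum>i<n. d j * (b i * (a i * c j)))"
      by (rule sum.swap)
    finally show ?thesis
      by (simp add: sum_distrib_left sum_distrib_right mult.assoc)
  qed
  ultimately have "(\<Sum>k\<in>{..<n} \<times> {..<m}. (a (fst k) * c (snd k)) \<odot> (d (snd k) * b (fst k)))
      \<in> N_Lie"
    by (intro N_LieI) (simp_all add: x y)
  then show "x * y \<in> N_Lie"
    by (simp add: x y sum_product env_tensor_mult sum.cartesian_product case_prod_unfold)
next
  fix c and x :: "('a, 'a opposite) tensor"
  assume "x \<in> N_Lie"
  then obtain n :: nat and a b where x: "x = (\<Sum>k<n. a k \<odot> b k)"
    "(\<Sum>k<n. a k * b k) = 0" "(\<Sum>k<n. b k * a k) = 0" by (blast elim: N_LieE)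
  then show "c *\<^sub>C x \<in> N_Lie"
    using N_LieI[of "{..<n}" "\<lambda>k. c *\<^sub>C a k" b]
    by (simp add: mult_scaleC_left mult_scaleC_right env_tensor_scaleC_left
        flip: complex_algebra.scale_sum_right)
qed

lemma T_Lie_subset_N_Lie: "T_Lie \<subseteq> N_Lie"
  unfolding T_Lie_def
proof (rule hull_minimal)
  show "{a \<otimes> 1 - 1 \<otimes> Opp a | a::'a. True} \<subseteq> N_Lie"
  proof clarify
    fix a :: 'a
    \<comment> \<open>The generator as a two-term sum; both contractions equal
      \<open>a - a\<close>.\<close>
    have "(\<Sum>k\<in>{True, False}. (if k then a else (- 1) *\<^sub>C 1) \<odot> (if k then 1 else a)) \<in> N_Lie"
      by (rule N_LieI) (simp_all add: mult_scaleC_left mult_scaleC_right)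
    then show "a \<otimes> 1 - 1 \<odot> a \<in> N_Lie"
      by (simp add: Opp_arith env_tensor_uminus_left)
  qed
qed (rule subalgebra_N_Lie)


section \<open>\<open>N_Lie\<close> is contained in \<open>T_Lie\<close>\<close>

locale minimal_decomposition =
  fixes P :: "'a::complex_algebra set"
  assumes orth_P: "orthogonal_minimal_idempotents P"
    and sum_P: "\<Sum>P = 1"
    and semiprime: "\<And>a::'a. (\<And>x. a * x * a = 0) \<Longrightarrow> a = 0"
begin

lemma finite_P: "finite P"
  and nonzero: "p \<in> P \<Longrightarrow> p \<noteq> 0"
  and idem: "p \<in> P \<Longrightarrow> p * p = p"
  and orth: "p \<in> P \<Longrightarrow> q \<in> P \<Longrightarrow> p \<noteq> q \<Longrightarrow> p * q = 0"
  and corner_scalar: "p \<in> P \<Longrightarrow> \<exists>c. p * x * p = c *\<^sub>C p"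
  using orth_P unfolding orthogonal_minimal_idempotents_def minimal_idempotent_def by auto

lemma idem_left: "p \<in> P \<Longrightarrow> p * (p * x) = p * x"
  and orth_left: "p \<in> P \<Longrightarrow> q \<in> P \<Longrightarrow> p \<noteq> q \<Longrightarrow> p * (q * x) = 0"
  by (simp_all add: idem orth flip: mult.assoc)

text \<open>Semiprimeness gives \<open>z * y * z\<close> nonzero. The products of \<open>z\<close>
  with \<open>q * y * p\<close> are multiples of \<open>p\<close> and \<open>q\<close>;
  associativity makes the two scalars equal, and this nonzero scalar is divided out.\<close>

lemma corner_inverse:
  assumes p: "p \<in> P" and q: "q \<in> P" and z: "p * z = z" "z * q = z" "z \<noteq> 0"
  obtains w where "q * w = w" "w * p = w" "z * w = p" "w * z = q"
proof -
  obtain y where y: "z * y * z \<noteq> 0" using semiprime z(3) by blast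
  let ?y = "q * y * p"
  have zy: "z * ?y = z * y * p" "?y * z = q * y * z"
    by (simp_all add: mult.assoc z) (simp add: z flip: mult.assoc)
  obtain c where c: "?y * z = c *\<^sub>C q"
    using corner_scalar[OF q, of "y * z"] z(2) zy(2) by (metis mult.assoc)
  obtain d where d: "z * ?y = d *\<^sub>C p"
    using corner_scalar[OF p, of "z * y"] z(1) zy(1) by (metis mult.assoc)
  have "c *\<^sub>C z = z * (?y * z)" by (simp add: c mult_scaleC_right z)
  also have "\<dots> = (z * ?y) * z" by (simp only: mult.assoc)
  also have "\<dots> = d *\<^sub>C z" by (simp only: d mult_scaleC_left z)
  finally have "c = d" using z(3) by simp
  have "z * (?y * z) = z * y * z"
    using z by (simp only: zy) (simp add: z flip: mult.assoc)
  then have "c \<noteq> 0" using y c by auto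
  show thesis
  proof
    let ?w = "inverse c *\<^sub>C ?y"
    show "q * ?w = ?w" by (simp add: mult_scaleC_right idem_left q mult.assoc)
    show "?w * p = ?w" by (simp add: mult_scaleC_left idem p mult.assoc)
    show "z * ?w = p" using d \<open>c = d\<close> \<open>c \<noteq> 0\<close> by (simp add: mult_scaleC_right)
    show "?w * z = q" using c \<open>c \<noteq> 0\<close> by (simp add: mult_scaleC_left)
  qed
qed

text \<open>With \<open>w\<close> inverse to \<open>z\<close>, \<open>y = (y * w) * z\<close>, and
  \<open>y * w\<close> lies in the scalar corner at \<open>p\<close>.\<close>

lemma corner_one_dimensional:
  assumes p: "p \<in> P" and q: "q \<in> P" and z: "p * z = z" "z * q = z" "z \<noteq> 0"
    and y: "p * y = y" "y * q = y"
  obtains c where "y = c *\<^sub>C z"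
proof -
  obtain w where w: "q * w = w" "w * p = w" "z * w = p" "w * z = q"
    using corner_inverse[OF p q z] .
  obtain c where c: "p * (y * w) * p = c *\<^sub>C p" using corner_scalar[OF p] by blast
  have "y = (p * (y * w) * p) * z"
    by (simp add: mult.assoc z w) (simp add: y flip: mult.assoc)
  also have "\<dots> = c *\<^sub>C z" by (simp add: c mult_scaleC_left z)
  finally show thesis using that by blast
qed

text \<open>By orthogonality \<open>ad_tensor p * ad_tensor s\<close> is minus the sum of
  \<open>p \<odot> s\<close> and \<open>s \<odot> p\<close>; another factor
  \<open>ad_tensor p\<close> turns the sum into the difference.\<close>

lemma T_Lie_off_diagonal_idem:
  assumes p: "p \<in> P" and s: "s \<in> P" and ne: "p \<noteq> s"
  shows "p \<odot> s \<in> T_Lie"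
proof -
  let ?x = "p \<odot> s" and ?y = "s \<odot> p"
  have e: "- (ad_tensor p * ad_tensor s) = ?x + ?y"
    using orth[OF p s ne] orth[OF s p] ne
    by (simp add: ad_tensor_def left_diff_distrib right_diff_distrib env_tensor_mult)
  have f: "ad_tensor p * (?x + ?y) = ?x - ?y"
    using orth[OF p s ne] orth[OF s p] ne idem[OF p]
    by (simp add: ad_tensor_def left_diff_distrib distrib_left env_tensor_mult)
  have "?x + ?y \<in> T_Lie"
    unfolding e[symmetric] by (intro T_Lie_uminus T_Lie_mult T_Lie_ad)
  moreover from this have "?x - ?y \<in> T_Lie"
    unfolding f[symmetric] by (intro T_Lie_mult T_Lie_ad)
  ultimately have "(1/2) *\<^sub>C ((?x + ?y) + (?x - ?y)) \<in> T_Lie"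
    by (rule T_Lie_scaleC[OF T_Lie_add])
  also have "(1/2) *\<^sub>C ((?x + ?y) + (?x - ?y)) = (1/2 + 1/2) *\<^sub>C ?x"
    unfolding complex_algebra.scale_left_distrib by (simp add: complex_algebra.scale_right_distrib)
  finally show ?thesis by (simp add: scaleC_one)
qed

text \<open>For \<open>p \<noteq> q\<close>, sandwiching \<open>ad_tensor a\<close> between
  \<open>p \<odot> s\<close> and \<open>q \<odot> s\<close> keeps \<open>a \<odot> s\<close>; the
  other term dies by \<open>p * q = 0\<close>.\<close>

lemma T_Lie_left_factor:
  assumes p: "p \<in> P" and q: "q \<in> P" and s: "s \<in> P" and ne: "p \<noteq> s" "q \<noteq> s"
    and a: "p * a = a" "a * q = a"
  shows "a \<odot> s \<in> T_Lie"
proof (cases "p = q")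
  case True
  then obtain c where "a = c *\<^sub>C p"
    using corner_scalar[OF p, of a] a by (metis mult.assoc)
  then show ?thesis
    by (simp add: env_tensor_scaleC_left T_Lie_scaleC T_Lie_off_diagonal_idem p s ne)
next
  case False
  have "(p \<odot> s) * ad_tensor a * (q \<odot> s) = a \<odot> s"
    using orth[OF p q False] a idem[OF s]
    by (simp add: ad_tensor_def left_diff_distrib right_diff_distrib env_tensor_mult mult.assoc)
  then show ?thesis
    by (metis T_Lie_mult T_Lie_ad T_Lie_off_diagonal_idem p q s ne)
qed

text \<open>The mirror sandwich, with \<open>q\<close> before \<open>p\<close> because the second
  tensor factor multiplies in reverse.\<close>

lemma T_Lie_right_factor:
  assumes p: "p \<in> P" and q: "q \<in> P" and s: "s \<in> P" and ne: "p \<noteq> s" "q \<noteq> s"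
    and a: "p * a = a" "a * q = a"
  shows "s \<odot> a \<in> T_Lie"
proof (cases "p = q")
  case True
  then obtain c where "a = c *\<^sub>C p"
    using corner_scalar[OF p, of a] a by (metis mult.assoc)
  then show ?thesis
    by (simp add: env_tensor_scaleC_right T_Lie_scaleC T_Lie_off_diagonal_idem p s ne[symmetric])
next
  case False
  have "- ((s \<odot> q) * ad_tensor a * (s \<odot> p)) = s \<odot> a"
    using orth[OF p q False] a idem[OF s]
    by (simp add: ad_tensor_def left_diff_distrib right_diff_distrib env_tensor_mult)
  then show ?thesis
    by (metis T_Lie_mult T_Lie_ad T_Lie_uminus T_Lie_off_diagonal_idem p q s ne)
qed

text \<open>These are the entries cut out by \<open>p \<odot> s\<close> on the left and
  \<open>q \<odot> r\<close> on the right. Unless \<open>q = s\<close> and \<open>p = r\<close>,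
  such an entry factors into the two one-sided cases.\<close>

lemma T_Lie_off_diagonal:
  assumes P: "p \<in> P" "q \<in> P" "r \<in> P" "s \<in> P" and ne: "p \<noteq> s" "q \<noteq> r"
    and a: "p * a = a" "a * q = a" and b: "r * b = b" "b * s = b"
  shows "a \<odot> b \<in> T_Lie"
proof -
  consider "q \<noteq> s" | "p \<noteq> r" | "q = s" "p = r" by blast
  then show ?thesis
  proof cases
    case 1
    have "a \<odot> b = (a \<odot> s) * (q \<odot> b)" by (simp add: env_tensor_mult a b)
    also have "\<dots> \<in> T_Lie"
      using 1 P ne a b T_Lie_left_factor[of p q s a] T_Lie_right_factor[of r s q b]
      by (intro T_Lie_mult) auto
    finally show ?thesis .
  next
    case 2
    have "a \<odot> b = (p \<odot> b) * (a \<odot> r)" by (simp add: env_tensor_mult a b)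
    also have "\<dots> \<in> T_Lie"
      using 2 P ne a b T_Lie_left_factor[of p q r a] T_Lie_right_factor[of r s p b]
      by (intro T_Lie_mult) auto
    finally show ?thesis .
  next
    \<comment> \<open>Now \<open>a\<close> and \<open>b\<close> share a corner of dimension at most
      one, and \<open>a * a = 0\<close> as \<open>p \<noteq> q\<close>, so the square of
      \<open>ad_tensor a\<close> is \<open>-2\<close> times \<open>a \<odot> a\<close>.\<close>
    case 3
    show ?thesis
    proof (cases "a = 0")
      case True
      then show ?thesis by (simp add: T_Lie_zero)
    next
      case False
      obtain c where c: "b = c *\<^sub>C a"
        using corner_one_dimensional[of p q a b] P a b 3 False by metis
      have "a * a = a * (q * p) * a" using a by (metis mult.assoc)
      then have aa: "a * a = 0" using orth[of q p] P ne 3 by simp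
      have "ad_tensor a * ad_tensor a = - (a \<odot> a + a \<odot> a)"
        by (simp add: ad_tensor_def left_diff_distrib right_diff_distrib env_tensor_mult aa)
      also have "\<dots> = (-2) *\<^sub>C (a \<odot> a)"
        using complex_algebra.scale_left_distrib[of 1 1 "a \<odot> a"] by simp
      finally have "a \<odot> b = (- c / 2) *\<^sub>C (ad_tensor a * ad_tensor a)"
        by (simp add: c env_tensor_scaleC_right)
      then show ?thesis by (simp only: T_Lie_scaleC T_Lie_mult T_Lie_ad)
    qed
  qed
qed

section \<open>Splitting the enveloping algebra along the diagonal\<close>

definition diag :: "('a, 'a opposite) tensor"
  where "diag = (\<Sum>p\<in>P. p \<odot> p)"

definition off_diag :: "('a, 'a opposite) tensor"
  where "off_diag = (\<Sum>(p, s)\<in>{(p, s). p \<in> P \<and> s \<in> P \<and> p \<noteq> s}. p \<odot> s)"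

lemma off_diag_plus_diag: "off_diag + diag = 1"
proof -
  have D: "diag = (\<Sum>(p, s)\<in>(\<lambda>p. (p, p)) ` P. p \<odot> s)"
    unfolding diag_def by (subst sum.reindex) (auto simp: inj_on_def)
  have "1 = \<Sum>P \<odot> \<Sum>P"
    by (simp only: env_tensor_one sum_P)
  also have "\<dots> = (\<Sum>p\<in>P. \<Sum>s\<in>P. p \<odot> s)"
    by (simp only: env_tensor_sum_left) (simp only: env_tensor_sum_right)
  also have "\<dots> = (\<Sum>(p, s)\<in>P \<times> P. p \<odot> s)"
    by (simp add: sum.cartesian_product)
  also have "P \<times> P = {(p, s). p \<in> P \<and> s \<in> P \<and> p \<noteq> s} \<union> (\<lambda>p. (p, p)) ` P"
    by auto
  also have "(\<Sum>(p, s)\<in>\<dots>. p \<odot> s) = off_diag + diag"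
    unfolding off_diag_def D
    by (rule sum.union_disjoint) (auto intro: finite_subset[of _ "P \<times> P"] simp: finite_P)
  finally show ?thesis by simp
qed

lemma T_Lie_off_diag_corner: "off_diag * x * off_diag \<in> T_Lie"
proof (induction x rule: env_tensor_induct)
  case (add x y)
  then show ?case by (simp add: distrib_left distrib_right T_Lie_add)
next
  case (tensor a b)
  show ?case
    unfolding off_diag_def sum_distrib_left sum_distrib_right
  proof (intro T_Lie_sum, clarify)
    fix p s q r assume "p \<in> P" "s \<in> P" "p \<noteq> s" "q \<in> P" "r \<in> P" "q \<noteq> r"
    then show "(p \<odot> s) * (a \<odot> b) * (q \<odot> r) \<in> T_Lie"
      by (auto simp: env_tensor_mult mult.assoc idem idem_left intro: T_Lie_off_diagonal[of p q r s])
  qed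
qed

text \<open>For equal idempotents both terms of \<open>ad_tensor c\<close> give the same multiple of
  \<open>p \<odot> p\<close>; for distinct ones orthogonality kills each term.\<close>

lemma diag_ad_diag: "diag * (ad_tensor c * diag) = 0"
proof -
  have "(p \<odot> p) * ad_tensor c * (q \<odot> q) = 0" if P: "p \<in> P" "q \<in> P" for p q
  proof (cases "p = q")
    case True
    obtain d where "p * c * p = d *\<^sub>C p" using corner_scalar P by blast
    then show ?thesis
      using True P by (simp add: ad_tensor_def left_diff_distrib right_diff_distrib env_tensor_mult
          idem env_tensor_scaleC_left env_tensor_scaleC_right flip: mult.assoc)
  next
    case False
    then show ?thesis
      using P by (simp add: ad_tensor_def left_diff_distrib right_diff_distrib env_tensor_mult orth)
  qed
  then show ?thesis
    unfolding diag_def sum_distrib_left sum_distrib_right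
    by (intro sum.neutral ballI) (simp add: mult.assoc)
qed

text \<open>As the diagonal block of each \<open>ad_tensor\<close> vanishes, every term of the
  expanded product is an \<open>off_diag\<close> corner, possibly flanked by outer
  \<open>ad_tensor\<close> factors.\<close>

lemma T_Lie_ad_mult_ad: "ad_tensor c * x * ad_tensor d \<in> T_Lie" for c d :: 'a
proof -
  have c: "ad_tensor c = ad_tensor c * off_diag + off_diag * (ad_tensor c * diag)" for c :: 'a
  proof -
    have "ad_tensor c = ad_tensor c * off_diag + (off_diag + diag) * (ad_tensor c * diag)"
      by (simp only: off_diag_plus_diag mult_1_left mult_1_right flip: distrib_left)
    then show ?thesis by (simp only: distrib_right diag_ad_diag add_0_right)
  qed
  have d: "ad_tensor d = off_diag * ad_tensor d + (diag * ad_tensor d) * off_diag"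
  proof -
    have "ad_tensor d = off_diag * ad_tensor d + (diag * ad_tensor d) * (off_diag + diag)"
      by (simp only: off_diag_plus_diag mult_1_left mult_1_right flip: distrib_right)
    then show ?thesis by (simp only: distrib_left diag_ad_diag mult.assoc add_0_right)
  qed
  let ?D = off_diag and ?c = "ad_tensor c" and ?d = "ad_tensor d"
  have "?c * x * ?d = (?c * ?D + ?D * (?c * diag)) * x * (?D * ?d + (diag * ?d) * ?D)"
    using c d by simp
  also have "\<dots> = ?c * (?D * x * ?D) * ?d + ?c * (?D * (x * diag * ?d) * ?D)
      + (?D * (?c * diag * x) * ?D) * ?d + ?D * (?c * diag * x * diag * ?d) * ?D"
    by (simp add: distrib_left distrib_right mult.assoc add.assoc)
  also have "\<dots> \<in> T_Lie"
    by (intro T_Lie_add T_Lie_mult T_Lie_ad T_Lie_off_diag_corner)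
  finally show ?thesis .
qed

section \<open>Simple blocks as classes of linked idempotents, and a separability element\<close>

definition linked :: "'a \<Rightarrow> 'a \<Rightarrow> bool"
  where "linked p q \<longleftrightarrow> (\<exists>x. p * x * q \<noteq> 0)"

text \<open>Here \<open>z\<close> and \<open>w\<close> act as the matrix units \<open>E p q\<close>
  and \<open>E q p\<close> of a common block.\<close>

lemma linkedE:
  assumes "linked p q" "p \<in> P" "q \<in> P"
  obtains z w where "p * z = z" "z * q = z" "q * w = w" "w * p = w" "z * w = p" "w * z = q"
proof -
  obtain x where x: "p * x * q \<noteq> 0" using assms(1) unfolding linked_def by blast
  have z: "p * (p * x * q) = p * x * q" "p * x * q * q = p * x * q"
    using assms by (simp_all add: mult.assoc idem idem_left)
  show thesis
    using corner_inverse[OF assms(2,3) z x] that z by metis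
qed

lemma linked_refl: "p \<in> P \<Longrightarrow> linked p p"
  unfolding linked_def by (rule exI[of _ 1]) (simp add: idem nonzero)

lemma linked_sym:
  assumes "linked p q" "p \<in> P" "q \<in> P"
  shows "linked q p"
proof -
  obtain z w where "p * z = z" "q * w = w" "w * p = w" "z * w = p"
    using linkedE[OF assms] by metis
  then have "q * w * p \<noteq> 0" using nonzero[OF assms(2)] by auto
  then show ?thesis unfolding linked_def by blast
qed

text \<open>Since \<open>w * z = q\<close> cancels \<open>z\<close>, a nonzero
  \<open>q * y * r\<close> stays nonzero after left multiplication by \<open>z\<close>.\<close>

lemma linked_trans:
  assumes "linked p q" "linked q r" "p \<in> P" "q \<in> P" "r \<in> P"
  shows "linked p r"
proof -
  obtain z w where z: "p * z = z" "w * z = q" "z * q = z" using linkedE[OF assms(1,3,4)] by metis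
  obtain y where y: "q * y * r \<noteq> 0" using assms(2) unfolding linked_def by blast
  have "w * (p * (z * y) * r) = q * y * r"
    using z by (metis mult.assoc)
  then have "p * (z * y) * r \<noteq> 0" using y by auto
  then show ?thesis unfolding linked_def by blast
qed

text \<open>With matrix units \<open>E p q\<close> and a base point \<open>o\<close> in each block, the element below is
  the sum of all \<open>E o p \<odot> E p o\<close>.\<close>

lemma separability_element:
  obtains v w :: "'a \<Rightarrow> 'a" where "(\<Sum>p\<in>P. w p * v p) = 1"
    and "\<And>c. (\<Sum>p\<in>P. (v p * c) \<odot> w p) = (\<Sum>p\<in>P. v p \<odot> (c * w p))"
proof -
  define base where "base p = (SOME r. r \<in> P \<and> linked p r)" for p
  have base: "base p \<in> P \<and> linked p (base p)" if "p \<in> P" for p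
    unfolding base_def by (rule someI[of _ p]) (use that linked_refl in auto)
  have base_cong: "base p = base q" if "p \<in> P" "q \<in> P" "linked p q" for p q
  proof -
    \<comment> \<open>Equal predicates make \<open>SOME\<close> pick the same base point throughout
      a block.\<close>
    have "(\<lambda>r. r \<in> P \<and> linked p r) = (\<lambda>r. r \<in> P \<and> linked q r)"
      using that linked_trans linked_sym by blast
    then show ?thesis unfolding base_def by simp
  qed
  have "\<forall>p\<in>P. \<exists>w v. p * w = w \<and> w * base p = w \<and> base p * v = v \<and> v * p = v
      \<and> w * v = p \<and> v * w = base p"
    using base linkedE by metis
  from bchoice[OF this] obtain w where "\<forall>p\<in>P. \<exists>v. p * w p = w p \<and> w p * base p = w p
      \<and> base p * v = v \<and> v * p = v \<and> w p * v = p \<and> v * w p = base p" ..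
  from bchoice[OF this] obtain v where "\<forall>p\<in>P. p * w p = w p \<and> w p * base p = w p
      \<and> base p * v p = v p \<and> v p * p = v p \<and> w p * v p = p \<and> v p * w p = base p" ..
  then have w: "\<And>p. p \<in> P \<Longrightarrow> p * w p = w p"
    "\<And>p. p \<in> P \<Longrightarrow> w p * base p = w p" "\<And>p. p \<in> P \<Longrightarrow> w p * v p = p"
    and v: "\<And>p. p \<in> P \<Longrightarrow> base p * v p = v p"
    "\<And>p. p \<in> P \<Longrightarrow> v p * p = v p" "\<And>p. p \<in> P \<Longrightarrow> v p * w p = base p"
    by blast+
  \<comment> \<open>Within a block both sides are \<open>d\<close> times
    \<open>v q \<odot> w p\<close>, where \<open>d\<close> is the matrix coefficient of
    \<open>c\<close> at \<open>p\<close>, \<open>q\<close>; across blocks both vanish.\<close>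
  have entry: "(v p * c * q) \<odot> w p = v q \<odot> (p * c * w q)" if P: "p \<in> P" "q \<in> P" for p q c
  proof (cases "linked p q")
    case True
    then have bq: "base q = base p" using base_cong P by metis
    obtain d where d: "base p * (v p * c * w q) * base p = d *\<^sub>C base p"
      using corner_scalar base P by blast
    have "base p * (v p * c * w q) * base p = (base p * v p) * c * (w q * base q)"
      by (simp add: mult.assoc bq)
    then have d: "v p * c * w q = d *\<^sub>C base p"
      using d v(1) w(2) P by simp
    have "v p * c * q = (v p * c * w q) * v q" using w(3) P by (simp add: mult.assoc)
    also have "\<dots> = d *\<^sub>C v q" using v(1)[OF P(2)] by (simp add: d mult_scaleC_left bq)
    finally have 1: "v p * c * q = d *\<^sub>C v q" .
    have "p * c * w q = w p * (v p * c * w q)" using w(3) P by (simp flip: mult.assoc)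
    also have "\<dots> = d *\<^sub>C w p" using w(2) P by (simp add: d mult_scaleC_right)
    finally show ?thesis using 1 by (simp add: env_tensor_scaleC_left env_tensor_scaleC_right)
  next
    case False
    then have "p * c * q = 0" unfolding linked_def by blast
    then have "v p * (p * c * q) = 0" "(p * c * q) * w q = 0" by simp_all
    then have "v p * c * q = 0" "p * c * w q = 0"
      using v(2)[OF P(1)] w(1)[OF P(2)] by (simp only: mult.assoc[symmetric], simp only: mult.assoc)
    then show ?thesis by simp
  qed
  have "(\<Sum>p\<in>P. (v p * c) \<odot> w p) = (\<Sum>p\<in>P. v p \<odot> (c * w p))" for c
  proof -
    \<comment> \<open>The unit inserted to the right of \<open>c\<close> splits the sum into
      entries; after the swap of sums a unit reassembles to the left of \<open>c\<close>.\<close>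
    have "(\<Sum>p\<in>P. (v p * c) \<odot> w p) = (\<Sum>p\<in>P. (v p * c * \<Sum>P) \<odot> w p)"
      by (simp add: sum_P)
    also have "\<dots> = (\<Sum>p\<in>P. \<Sum>q\<in>P. v q \<odot> (p * c * w q))"
      by (simp add: sum_distrib_left env_tensor_sum_left entry)
    also have "\<dots> = (\<Sum>q\<in>P. v q \<odot> (\<Sum>P * c * w q))"
      by (subst sum.swap) (simp add: sum_distrib_right env_tensor_sum_right)
    finally show ?thesis by (simp add: sum_P)
  qed
  moreover have "(\<Sum>p\<in>P. w p * v p) = 1" using w(3) sum_P by simp
  ultimately show thesis using that by blast
qed

text \<open>The two conditions act separately: \<open>ba\<close> gives \<open>u * x = 0\<close>, as
  \<open>u\<close> carries each \<open>a k\<close> into the right factor, and \<open>ab\<close>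
  makes \<open>- x\<close> the sum of the \<open>(a k \<odot> 1) * ad_tensor (b k)\<close>. So
  \<open>x = (1 - u) * x\<close> has an \<open>ad_tensor\<close> at both ends of each term.\<close>

lemma N_Lie_subset_T_Lie: "(N_Lie :: ('a, 'a opposite) tensor set) \<subseteq> T_Lie"
proof
  fix x :: "('a, 'a opposite) tensor"
  assume "x \<in> N_Lie"
  then obtain n :: nat and a b where x: "x = (\<Sum>k<n. a k \<odot> b k)"
    and ab: "(\<Sum>k<n. a k * b k) = 0" and ba: "(\<Sum>k<n. b k * a k) = 0" by (blast elim: N_LieE)
  obtain v w :: "'a \<Rightarrow> 'a" where vw: "(\<Sum>p\<in>P. w p * v p) = 1"
    and sep: "\<And>c. (\<Sum>p\<in>P. (v p * c) \<odot> w p) = (\<Sum>p\<in>P. v p \<odot> (c * w p))"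
    using separability_element by blast
  define u where "u = (\<Sum>p\<in>P. v p \<odot> w p)"
  have "u * (a k \<odot> b k) = (\<Sum>p\<in>P. v p \<odot> (b k * a k * w p))" for k
  proof -
    have "u * (a k \<odot> b k) = (\<Sum>p\<in>P. (v p * a k) \<odot> w p) * (1 \<odot> b k)"
      by (simp add: u_def sum_distrib_right env_tensor_mult)
    then show ?thesis
      by (simp add: sep sum_distrib_right env_tensor_mult mult.assoc)
  qed
  then have "u * x = (\<Sum>p\<in>P. v p \<odot> ((\<Sum>k<n. b k * a k) * w p))"
    unfolding x sum_distrib_left sum_distrib_right env_tensor_sum_right
    by (simp add: sum.swap[of _ P])
  then have "u * x = 0" by (simp add: ba)
  moreover have u: "(\<Sum>p\<in>P. ad_tensor (w p) * (v p \<odot> 1)) = 1 - u"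
    by (simp add: ad_tensor_def left_diff_distrib env_tensor_mult sum_subtractf u_def vw
        env_tensor_one flip: env_tensor_sum_left)
  moreover have "(\<Sum>k<n. (a k \<odot> 1) * ad_tensor (b k)) = - x"
    by (simp add: ad_tensor_def right_diff_distrib env_tensor_mult sum_subtractf x ab
        flip: env_tensor_sum_left)
  ultimately have "x = - ((\<Sum>p\<in>P. ad_tensor (w p) * (v p \<odot> 1)) * (\<Sum>k<n. (a k \<odot> 1) * ad_tensor (b k)))"
    by (simp add: left_diff_distrib)
  also have "\<dots> = - (\<Sum>p\<in>P. \<Sum>k<n. ad_tensor (w p) * ((v p \<odot> 1) * (a k \<odot> 1)) * ad_tensor (b k))"
    by (simp add: sum_product mult.assoc)
  also have "\<dots> \<in> T_Lie"
    by (intro T_Lie_uminus T_Lie_sum T_Lie_ad_mult_ad)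
  finally show "x \<in> T_Lie" .
qed

end

theorem theorem2p11:
  assumes "finite_dimensional TYPE('b::complex_algebra)"
    and "semisimple TYPE('b)"
  shows "(T_Lie :: ('b, 'b opposite) tensor set) = N_Lie"
proof -
  have semiprime: "(\<And>x. a * x * a = 0) \<Longrightarrow> a = 0" for a :: 'b
    by (rule semisimple_semiprime[OF assms(2)])
  obtain P :: "'b set" where "orthogonal_minimal_idempotents P" "\<Sum>P = 1"
    using minimal_idempotent_decomposition[OF assms(1) semiprime] by blast
  then interpret minimal_decomposition P
    by unfold_locales (use semiprime in blast)+
  show ?thesis
    using T_Lie_subset_N_Lie N_Lie_subset_T_Lie by (rule subset_antisym)
qed

end
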